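(* Let $n\geq 1$. The map $\phi_R$ is defined on every element of $\mathcal{R}'_{[n]}$ and maps $\mathcal{R}'_{[n]}$ to $\mathcal{D}_{[n]}$, the map $\psi_R$ maps $\mathcal{D}_{[n]}$ to $\mathcal{R}'_{[n]}$, and $\phi_R:\mathcal{R}'_{[n]}\to\mathcal{D}_{[n]}$ and $\psi_R:\mathcal{D}_{[n]}\to\mathcal{R}'_{[n]}$ are bijections (indeed mutually inverse).
   Context: For a finite set $P$ of positive integers with $|P|=n$, a permutation $w$ of $P$ is written as a word $w=w_1\cdots w_n$ with $\{w_1,\dots,w_n\}=P$; $w^*=w_n\cdots w_1$ is its reversal; $w[i,j]=w_i\cdots w_j$ is a (contiguous) subword, proper if $\neq w$; commas denote concatenation. For $|P|\geq 2$, $w$ is an R-word if (R1) $w_1=\max(P)$ and $w_n=\max(P\setminus\{w_1\})$, and (R2) if $n\geq4$ then $w_2<w_{n-1}$; it is a primitive R-word if for every proper subword $x$ of length $\geq 4$, neither $x$ nor $x^*$ is an R-word. For a finite nonempty $P$ with $m=\max(P)$, let $\mathcal{R}'_P$ be the set of permutations $w$ of $P$ such that $(m+2,w,m+1)$ is a primitive R-word (on $P\cup\{m+1,m+2\}$). A decreasing 012-tree on vertex set $P$ is a rooted tree with vertices labeled by the distinct elements of $P$, every vertex having $0$, $1$ or $2$ (unordered) children, with $x<y$ whenever $x$ is a descendant of $y$ (so the root is $\max P$); $\mathcal{D}_P$ is the set of these. Write $[v,T_1,\dots,T_r]$ for the tree with root $v$ whose children root the subtrees $T_1,\dots,T_r$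 (order irrelevant). For a word $w$ on a finite nonempty set $P$ with $m=\max(P)$, $|P|=n$, and $k$ the position of $m$ in $w$, define recursively $\phi_R(w)=[m]$ if $n=1$; $\phi_R(w)=[m,\phi_R(w[1,n-1]^* )]$ if $n>1$ and $k=n$; $\phi_R(w)=[m,\phi_R(w[1,k-1]^* ),\phi_R(w[k+1,n])]$ if $n>1$ and $2\le k\le n-1$. For $T\in\mathcal{D}_P$, define recursively $\psi_R(T)=v$ if $T$ is a single vertex $v$; $\psi_R([v,T'])=(\psi_R(T')^*,v)$; and $\psi_R([v,T',T''])=(\psi_R(T')^*,v,\psi_R(T''))$, where the two subtrees are labeled $T',T''$ so that the last digit of $\psi_R(T')$ is less than the last digit of $\psi_R(T'')$. *)

theory Defs
  imports Main "HOL-Library.Multiset" "HOL-Library.Sublist"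
    "HOL-Combinatorics.Multiset_Permutations"
begin

section \<open>R-words\<close>

text \<open>
  A permutation of a finite set \<open>P\<close> is a word (list) in \<^term>\<open>permutations_of_set P\<close>, i.e. a
  distinct list \<open>w\<close> with \<^prop>\<open>set w = P\<close>. As \<open>P\<close> is determined by the word, being an R-word is
  a predicate on the word alone. Lists are indexed from 0, so the letters written \<open>w\<^sub>2\<close> and
  \<open>w\<^sub>n\<^sub>-\<^sub>1\<close> on paper are \<open>w ! 1\<close> and \<open>w ! (n - 2)\<close>.
\<close>

definition R_word :: "nat list \<Rightarrow> bool" where
  "R_word w \<longleftrightarrow>
     distinct w \<and> length w \<ge> 2 \<and>
     hd w = Max (set w) \<and> last w = Max (set w - {hd w}) \<and>
     (length w \<ge> 4 \<longrightarrow> w ! 1 < w ! (length w - 2))"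

definition primitive_R_word :: "nat list \<Rightarrow> bool" where
  "primitive_R_word w \<longleftrightarrow>
     R_word w \<and>
     (\<forall>x. strict_sublist x w \<and> length x \<ge> 4 \<longrightarrow> \<not> R_word x \<and> \<not> R_word (rev x))"

definition R_perms :: "nat set \<Rightarrow> nat list set" where
  "R_perms P =
     {w \<in> permutations_of_set P. primitive_R_word ((Max P + 2) # w @ [Max P + 1])}"


section \<open>Decreasing 012-trees\<close>

text \<open>Rooted trees with labelled vertices; the children of a vertex are unordered.\<close>

datatype tree = Node nat "tree multiset"

primrec labels :: "tree \<Rightarrow> nat multiset" where
  "labels (Node v ts) = add_mset v (\<Sum>\<^sub># (image_mset labels ts))"

inductive decreasing_012 :: "tree \<Rightarrow> bool" where
  "size ts \<le> 2 \<Longrightarrow>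
   (\<And>t x. t \<in># ts \<Longrightarrow> x \<in># labels t \<Longrightarrow> x < v) \<Longrightarrow>
   (\<And>t. t \<in># ts \<Longrightarrow> decreasing_012 t) \<Longrightarrow>
   decreasing_012 (Node v ts)"

text \<open>
  Comparing label multisets with \<^term>\<open>mset_set P\<close> says that every element of \<open>P\<close> labels exactly
  one vertex.
\<close>

definition decreasing_012_trees :: "nat set \<Rightarrow> tree set" where
  "decreasing_012_trees P = {T. decreasing_012 T \<and> labels T = mset_set P}"


section \<open>The two maps\<close>

text \<open>
  The word \<open>w\<close> is split at its maximum \<open>m\<close>, at position \<open>k\<close> (counted from 1), into
  \<open>u = w[1,k-1]\<close> and \<open>u' = w[k+1,n]\<close>. The value \<^const>\<open>None\<close> means that the recursion is
  undefined: this happens if it reaches a word of length greater than 1 whose maximum is its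
  first letter (or the empty word).
\<close>

function phi_R :: "nat list \<Rightarrow> tree option" where
  "phi_R w =
     (if w = [] then None
      else
        let m = Max (set w);
            u = takeWhile (\<lambda>x. x \<noteq> m) w;
            u' = tl (dropWhile (\<lambda>x. x \<noteq> m) w)
        in
          if length w = 1 then Some (Node m {#})
          else if u = [] then None
          else if u' = [] then
            (case phi_R (rev u) of
               Some T \<Rightarrow> Some (Node m {#T#})
             | None \<Rightarrow> None)
          else
            (case (phi_R (rev u), phi_R u') of
               (Some T, Some T') \<Rightarrow> Some (Node m {#T, T'#})
             | _ \<Rightarrow> None))"
  by pat_completeness auto
termination
proof (relation "measure length", goal_cases)
  case 1
  show ?case by simp
next
  case (2 w m u u')
  then have "Max (set w) \<in> set w" by simp
  then have "length (takeWhile (\<lambda>x. x \<noteq> Max (set w)) w) < length w"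
    by (metis (full_types) length_takeWhile_le linorder_neqE_nat not_le set_takeWhileD
        takeWhile_eq_all_conv takeWhile_eq_take take_all order_refl)
  with 2 show ?case by simp
next
  case (3 w m u u')
  then have "Max (set w) \<in> set w" by simp
  then have "length (takeWhile (\<lambda>x. x \<noteq> Max (set w)) w) < length w"
    by (metis (full_types) length_takeWhile_le linorder_neqE_nat not_le set_takeWhileD
        takeWhile_eq_all_conv takeWhile_eq_take take_all order_refl)
  with 3 show ?case by simp
next
  case (4 w m u u')
  have "length (dropWhile (\<lambda>x. x \<noteq> m) w) \<le> length w"
    by (rule length_dropWhile_le)
  moreover have "length w > 0" using 4 by simp
  ultimately have "length u' < length w" unfolding 4 length_tl by linarith
  then show ?case by simp
qed

declare phi_R.simps [simp del]

text \<open>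
  \<open>psi_R_node v M w\<close>: the word \<open>w\<close> is obtained for a root \<open>v\<close> whose subtrees have the words in
  the multiset \<open>M\<close>. At most one such \<open>w\<close> exists; in the third case the condition on the last
  letters decides which subtree comes first. A word \<open>w\<close> need not exist (more than two subtrees,
  or two with equal last letters); nothing is known about the value of \<open>psi_R\<close> in that case.
\<close>

inductive psi_R_node :: "nat \<Rightarrow> nat list multiset \<Rightarrow> nat list \<Rightarrow> bool" where
  "psi_R_node v {#} [v]"
| "psi_R_node v {#u#} (rev u @ [v])"
| "last u < last u' \<Longrightarrow> psi_R_node v {#u, u'#} (rev u @ [v] @ u')"

primrec psi_R :: "tree \<Rightarrow> nat list" where
  "psi_R (Node v ts) = (THE w. psi_R_node v (image_mset psi_R ts) w)"

end

theory Submission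
  imports Defs
begin

text \<open>
  Write a word as \<open>w = (s, m, t)\<close> with \<open>m\<close> its maximum. A subword of \<open>(m+2, w, m+1)\<close> that is an
  R-word up to reversal has its two largest letters at its ends, so unless it is the whole word it
  lies in \<open>(m+2, s, m)\<close> or in \<open>(m, t, m+1)\<close>. Which of the two ends is larger matters only for these
  two words themselves: excluding the first forces the last letter of \<open>s\<close> below its first one,
  excluding the second forces the first letter of \<open>t\<close> below its last one. Hence, for words of length
  at least 2, \<open>(m+2, w, m+1)\<close> is primitive iff \<open>s\<close> is nonempty, \<open>s\<^sup>*\<close> has the same property, and
  \<open>t\<close> is empty or has it too with last letter exceeding the first letter of \<open>s\<close>. Both maps follow
  this recursion.
\<close>

section \<open>Forbidden subwords\<close>

text \<open>\<open>forbidden p y q\<close>: the word \<open>(p, y, q)\<close> is, up to reversal, an R-word of length at least 4.\<close>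

definition forbidden :: "nat \<Rightarrow> nat list \<Rightarrow> nat \<Rightarrow> bool" where
  "forbidden p y q \<longleftrightarrow> 2 \<le> length y \<and> p \<noteq> q \<and> (\<forall>x\<in>set y. x < p \<and> x < q) \<and>
     (if q < p then hd y < last y else last y < hd y)"

definition avoiding :: "nat list \<Rightarrow> bool" where
  "avoiding v \<longleftrightarrow> (\<forall>p y q. sublist (p # y @ [q]) v \<longrightarrow> \<not> forbidden p y q)"

text \<open>A proper subword of \<open>(m+2, w, m+1)\<close> misses one of the two end letters, so
  only \<open>w\<close> extended on one side has to be tested. Any letter above all of
  \<open>w\<close> serves as extension, hence the quantified \<open>a\<close>.\<close>

definition border_avoiding :: "nat list \<Rightarrow> bool" where
  "border_avoiding w \<longleftrightarrow>
     (\<forall>a. (\<forall>x\<in>set w. x < a) \<longrightarrow> avoiding (a # w) \<and> avoiding (w @ [a]))"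

text \<open>Primitivity of the framed word, stated without its frame so that it can be passed to
  shorter words; the last conjunct is (R2) for the framed word.\<close>

definition core :: "nat list \<Rightarrow> bool" where
  "core w \<longleftrightarrow> w \<noteq> [] \<and> distinct w \<and> border_avoiding w \<and> (2 \<le> length w \<longrightarrow> hd w < last w)"

section \<open>R-words described by their end letters\<close>

lemma R_word_Cons_snoc:
  "R_word (p # y @ [q]) \<longleftrightarrow>
     distinct y \<and> q < p \<and> (\<forall>x\<in>set y. x < q) \<and> (2 \<le> length y \<longrightarrow> hd y < last y)"
proof -
  have max1: "p = Max (insert p (insert q (set y))) \<longleftrightarrow> q \<le> p \<and> (\<forall>x\<in>set y. x \<le> p)"
    by (subst eq_commute, subst Max_eq_iff) auto
  have max2: "q = Max (insert q (set y)) \<longleftrightarrow> (\<forall>x\<in>set y. x \<le> q)"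
    by (subst eq_commute, subst Max_eq_iff) auto
  have diff: "insert p (insert q (set y)) - {p} = insert q (set y)" if "distinct (p # y @ [q])"
    using that by auto
  \<comment> \<open>The two letters compared in (R2), after simplification of the indices
    \<open>1\<close> and \<open>length - 2\<close>.\<close>
  have second: "(y @ [q]) ! 0 = hd y" "(p # y @ [q]) ! length y = last y"
    if "2 \<le> length y"
    using that by (cases y; simp add: nth_append hd_conv_nth last_conv_nth nth_Cons')+
  show ?thesis
  proof (cases "distinct (p # y @ [q])")
    case True
    have "R_word (p # y @ [q]) \<longleftrightarrow> q \<le> p \<and> (\<forall>x\<in>set y. x \<le> p) \<and> (\<forall>x\<in>set y. x \<le> q) \<and>
        (2 \<le> length y \<longrightarrow> hd y < last y)"
      using True diff[OF True] second unfolding R_word_def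
      by (auto simp: max1 max2 simp del: Max_insert)
    also have "\<dots> \<longleftrightarrow> q < p \<and> (\<forall>x\<in>set y. x < q) \<and> (2 \<le> length y \<longrightarrow> hd y < last y)"
      using True by (fastforce simp: order_le_less)
    finally show ?thesis
      using True by simp
  next
    case False
    then show ?thesis
      by (auto simp: R_word_def)
  qed
qed

text \<open>Only the reading that begins with the larger end letter can be an R-word; this is the
  case split on \<open>q < p\<close> in \<open>forbidden\<close>.\<close>

lemma forbidden_iff_R_word:
  assumes "distinct y" "2 \<le> length y"
  shows "forbidden p y q \<longleftrightarrow> R_word (p # y @ [q]) \<or> R_word (rev (p # y @ [q]))"
proof -
  have "rev (p # y @ [q]) = q # rev y @ [p]"
    by simp
  moreover have "y \<noteq> []"
    using assms by auto
  ultimately show ?thesis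
    using assms unfolding forbidden_def
    by (simp only: R_word_Cons_snoc) (auto simp: hd_rev last_rev dest: less_trans)
qed

section \<open>Contiguous subwords, reversal and framing letters\<close>

lemma sublist_Cons_snoc:
  "sublist x (a # w @ [b]) \<longleftrightarrow> x = a # w @ [b] \<or> sublist x (a # w) \<or> sublist x (w @ [b])"
proof -
  have "sublist x (w @ [b])" if "sublist x w"
    using that by (simp add: sublist_append)
  moreover have "prefix x (a # w @ [b]) \<longleftrightarrow> x = a # w @ [b] \<or> prefix x (a # w)"
    using prefix_snoc[of x "a # w" b] by simp
  ultimately show ?thesis
    unfolding sublist_Cons_right[of x a] by blast
qed

lemma distinct_sublist: "sublist u v \<Longrightarrow> distinct v \<Longrightarrow> distinct u"
  by (auto simp: sublist_def)

lemma avoiding_sublist: "avoiding v \<Longrightarrow> sublist u v \<Longrightarrow> avoiding u"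
  unfolding avoiding_def using sublist_order.order_trans by blast

lemma avoiding_rev:
  assumes "avoiding v"
  shows "avoiding (rev v)"
  unfolding avoiding_def
proof (intro allI impI notI)
  fix p y q
  assume "sublist (p # y @ [q]) (rev v)" "forbidden p y q"
  moreover from this have "forbidden q (rev y) p"
    by (cases "y = []") (auto simp: forbidden_def hd_rev last_rev split: if_splits)
  moreover have "sublist (q # rev y @ [p]) v"
    using calculation(1) by (simp add: sublist_rev_right)
  ultimately show False
    using assms by (auto simp: avoiding_def)
qed

lemma avoiding_Cons_snoc:
  "avoiding (p # y @ [q]) \<longleftrightarrow> avoiding (p # y) \<and> avoiding (y @ [q]) \<and> \<not> forbidden p y q"
proof -
  have "avoiding (p # y @ [q]) \<longleftrightarrow> (\<forall>p' y' q'. p' # y' @ [q'] = p # y @ [q] \<or>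
      sublist (p' # y' @ [q']) (p # y) \<or> sublist (p' # y' @ [q']) (y @ [q]) \<longrightarrow>
      \<not> forbidden p' y' q')"
    unfolding avoiding_def sublist_Cons_snoc[of _ p y q] ..
  also have "\<dots> \<longleftrightarrow> avoiding (p # y) \<and> avoiding (y @ [q]) \<and> \<not> forbidden p y q"
    unfolding avoiding_def list.inject append1_eq_conv by blast
  finally show ?thesis .
qed

text \<open>A subword that uses the added letter starts with it and has its other letters in
  \<open>w\<close>. All of these are smaller, so the comparisons in \<open>forbidden\<close> come
  out the same for \<open>a\<close> and \<open>b\<close>.\<close>

lemma avoiding_Cons_indep:
  assumes "\<forall>x\<in>set w. x < a" "\<forall>x\<in>set w. x < b" "avoiding (a # w)"
  shows "avoiding (b # w)"
  unfolding avoiding_def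
proof (intro allI impI notI)
  fix p y q
  assume sub: "sublist (p # y @ [q]) (b # w)" and forb: "forbidden p y q"
  from sub consider "sublist (p # y @ [q]) w" | "p = b" "prefix (y @ [q]) w"
    by (auto simp: sublist_Cons_right)
  then show False
  proof cases
    case 1
    then show False
      using assms(3) forb unfolding avoiding_def by (auto simp: sublist_Cons_right)
  next
    case 2
    then have "q \<in> set w" "set y \<subseteq> set w"
      using set_mono_prefix by fastforce+
    then have "forbidden a y q"
      using forb 2 assms(1,2) unfolding forbidden_def by (auto dest: less_trans)
    moreover have "sublist (a # y @ [q]) (a # w)"
      using 2 by (auto simp: sublist_Cons_right)
    ultimately show False
      using assms(3) by (auto simp: avoiding_def)
  qed
qed

lemma avoiding_snoc_indep:
  assumes "\<forall>x\<in>set w. x < a" "\<forall>x\<in>set w. x < b" "avoiding (w @ [a])"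
  shows "avoiding (w @ [b])"
  using avoiding_rev[OF avoiding_Cons_indep[of "rev w" a b]] avoiding_rev[OF assms(3)] assms(1,2)
  by simp

lemma border_avoidingI:
  assumes "\<forall>x\<in>set w. x < a" "\<forall>x\<in>set w. x < b" "avoiding (a # w)" "avoiding (w @ [b])"
  shows "border_avoiding w"
  using assms avoiding_Cons_indep avoiding_snoc_indep unfolding border_avoiding_def by blast

lemma border_avoiding_rev [simp]: "border_avoiding (rev w) \<longleftrightarrow> border_avoiding w"
proof -
  have "border_avoiding (rev w)" if "border_avoiding w" for w
    unfolding border_avoiding_def
  proof (intro allI impI conjI)
    fix a
    assume "\<forall>x\<in>set (rev w). x < a"
    with that have "avoiding (a # w)" "avoiding (w @ [a])"
      by (auto simp: border_avoiding_def)
    from this[THEN avoiding_rev] show "avoiding (a # rev w)" "avoiding (rev w @ [a])"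
      by simp_all
  qed
  from this[of w] this[of "rev w"] show ?thesis
    by auto
qed

text \<open>A forbidden subword with letters on both sides of \<open>m\<close> has \<open>m\<close>
  strictly inside, so both of its ends exceed \<open>m\<close>. One end lies in \<open>A\<close> and
  the other in \<open>B\<close>, so a bound by \<open>m\<close> on either side excludes this. All
  other subwords lie in \<open>A @ [m]\<close> or \<open>m # B\<close>.\<close>

lemma avoiding_split:
  assumes "avoiding (A @ [m])" "avoiding (m # B)" "(\<forall>x\<in>set A. x \<le> m) \<or> (\<forall>x\<in>set B. x \<le> m)"
  shows "avoiding (A @ m # B)"
  unfolding avoiding_def
proof (intro allI impI notI)
  fix p y q
  assume sub: "sublist (p # y @ [q]) (A @ m # B)" and forb: "forbidden p y q"
  from sub consider "sublist (p # y @ [q]) (A @ [m])" | "sublist (p # y @ [q]) (m # B)"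
    | xs ys where "p # y @ [q] = xs @ m # ys" "suffix xs A" "prefix ys B" "xs \<noteq> []" "ys \<noteq> []"
  proof (subst (asm) sublist_append, elim disjE exE conjE)
    fix xs1 xs2
    assume *: "p # y @ [q] = xs1 @ xs2" "suffix xs1 A" "prefix xs2 (m # B)"
    show thesis
    proof (cases xs2)
      case Nil
      then have "sublist (p # y @ [q]) (A @ [m])"
        using * by (simp add: sublist_append)
      then show thesis by (rule that)
    next
      case (Cons m' ys)
      then have [simp]: "m' = m" "prefix ys B"
        using * by auto
      consider "xs1 = []" | "ys = []" | "xs1 \<noteq> []" "ys \<noteq> []"
        by blast
      then show thesis
      proof cases
        case 1
        then show thesis
          using * that(2) by simp
      next
        case 2
        then have "suffix (p # y @ [q]) (A @ [m])"
          using * Cons by (simp only: suffix_def) auto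
        then have "sublist (p # y @ [q]) (A @ [m])"
          by (rule suffix_imp_sublist)
        then show thesis by (rule that)
      next
        case 3
        then show thesis
          using that(3) * Cons by simp
      qed
    qed
  qed (use that sublist_append in blast)+
  then show False
  proof cases
    case 3
    from 3 obtain xs' where xs: "xs = p # xs'" and "y @ [q] = xs' @ m # ys"
      by (cases xs) auto
    moreover from 3 obtain ys' where ys: "ys = ys' @ [q]"
      by (cases ys rule: rev_cases) auto
    ultimately have "m \<in> set y"
      by simp
    moreover have "p \<in> set A" "q \<in> set B"
      using 3 xs ys set_mono_suffix set_mono_prefix by fastforce+
    ultimately show False
      using assms(3) forb unfolding forbidden_def by (meson leD)
  qed (use assms forb in \<open>auto simp: avoiding_def\<close>)
qed

section \<open>Splitting a word at its maximum\<close>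

text \<open>With a frame letter \<open>a\<close> above \<open>m\<close>, everything reduces to
  \<open>(a, s, m)\<close> and \<open>(m, t, a)\<close>. The larger end is on the left in the first
  and on the right in the second, so excluding these two words orients \<open>s\<close> and
  \<open>t\<close> oppositely.\<close>

lemma border_avoiding_split:
  assumes "distinct (s @ m # t)" "\<forall>x\<in>set s \<union> set t. x < m"
  shows "border_avoiding (s @ m # t) \<longleftrightarrow>
    border_avoiding s \<and> (2 \<le> length s \<longrightarrow> last s < hd s) \<and>
    border_avoiding t \<and> (2 \<le> length t \<longrightarrow> hd t < last t)"
proof -
  define a where "a = Suc m"
  have ma: "m < a" and sa: "\<forall>x\<in>set s. x < a" and ta: "\<forall>x\<in>set t. x < a"
    and sm: "\<forall>x\<in>set s. x < m" and tm: "\<forall>x\<in>set t. x < m"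
    using assms(2) by (auto simp: a_def less_Suc_eq)
  \<comment> \<open>Lets the negation of a strict comparison of end letters become the reverse
    strict one.\<close>
  have ends: "hd u \<noteq> last u" if "distinct u" "2 \<le> length u" for u :: "nat list"
    using that by (cases u; cases "tl u" rule: rev_cases) auto
  have left: "avoiding (a # s @ [m]) \<longleftrightarrow>
      border_avoiding s \<and> (2 \<le> length s \<longrightarrow> last s < hd s)"
    using ends[of s] assms(1) sm sa ma border_avoidingI[OF sa sm]
    by (auto simp: avoiding_Cons_snoc forbidden_def border_avoiding_def)
  have right: "avoiding (m # t @ [a]) \<longleftrightarrow>
      border_avoiding t \<and> (2 \<le> length t \<longrightarrow> hd t < last t)"
    using ends[of t] assms(1) tm ta ma border_avoidingI[OF tm ta]
    by (auto simp: avoiding_Cons_snoc forbidden_def border_avoiding_def)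
  have all: "\<forall>x\<in>set (s @ m # t). x < a"
    using sa ta ma by auto
  have "border_avoiding (s @ m # t) \<longleftrightarrow> avoiding (a # s @ m # t) \<and> avoiding (s @ m # t @ [a])"
    using all border_avoidingI[OF all all] by (auto simp: border_avoiding_def)
  also have "\<dots> \<longleftrightarrow> avoiding (a # s @ [m]) \<and> avoiding (m # t @ [a])"
  proof (intro iffI conjI; elim conjE)
    assume *: "avoiding (a # s @ m # t)" "avoiding (s @ m # t @ [a])"
    have "sublist (a # s @ [m]) (a # s @ m # t)"
      unfolding sublist_def by (rule exI[of _ "[]"], rule exI[of _ t]) simp
    then show "avoiding (a # s @ [m])"
      using * avoiding_sublist by blast
    have "sublist (m # t @ [a]) (s @ m # t @ [a])"
      unfolding sublist_def by (rule exI[of _ s], rule exI[of _ "[]"]) simp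
    then show "avoiding (m # t @ [a])"
      using * avoiding_sublist by blast
  next
    assume *: "avoiding (a # s @ [m])" "avoiding (m # t @ [a])"
    have sub: "avoiding (m # t)" "avoiding (s @ [m])"
      using * by (auto simp: avoiding_Cons_snoc[of m t] avoiding_Cons_snoc[of a s])
    \<comment> \<open>Here \<open>a\<close> exceeds \<open>m\<close> on the left, so the bound
      required by \<open>avoiding_split\<close> comes from \<open>t\<close>; in the mirrored case it
      comes from \<open>s\<close>.\<close>
    show "avoiding (a # s @ m # t)"
      using avoiding_split[of "a # s" m t] * sub tm by (auto simp: less_imp_le)
    show "avoiding (s @ m # t @ [a])"
      using avoiding_split[of s m "t @ [a]"] * sub sm by (auto simp: less_imp_le)
  qed
  finally show ?thesis
    using left right by blast
qed

lemma core_singleton: "core [m]"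
  unfolding core_def border_avoiding_def avoiding_def forbidden_def
  by (auto dest!: sublist_length_le)

lemma border_avoiding_Nil: "border_avoiding []"
  unfolding border_avoiding_def avoiding_def
  by (auto dest!: sublist_length_le)

text \<open>Reversing \<open>s\<close> turns \<open>last s < hd s\<close> into the orientation that
  \<open>core\<close> asks for. The end letter condition of the whole word fails if \<open>s\<close>
  is empty, as the word then starts with its maximum; it is automatic if \<open>t\<close> is empty,
  and is \<open>hd s < last t\<close> otherwise.\<close>

lemma core_split:
  assumes "distinct (s @ m # t)" "\<forall>x\<in>set s \<union> set t. x < m" "s @ t \<noteq> []"
  shows "core (s @ m # t) \<longleftrightarrow>
    s \<noteq> [] \<and> core (rev s) \<and> (t \<noteq> [] \<longrightarrow> core t \<and> hd s < last t)"
proof (cases "s = []")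
  case True
  then have "last t < m"
    using assms by auto
  then show ?thesis
    using True assms(3) by (auto simp: core_def Suc_le_eq)
next
  case False
  then have "hd s < m"
    using assms by auto
  then show ?thesis
    using False assms(1)
    unfolding core_def border_avoiding_split[OF assms(1,2)]
    by (cases "t = []") (auto simp: hd_rev last_rev border_avoiding_Nil Suc_le_eq)
qed

text \<open>The framed word being an R-word gives \<open>hd w < last w\<close>. Its proper subwords
  lie in \<open>a # w\<close> or \<open>w @ [b]\<close>, and \<open>border_avoidingI\<close> frees
  the result from the particular \<open>a\<close> and \<open>b\<close>.\<close>

lemma primitive_R_word_iff_core:
  assumes "w \<noteq> []" "distinct w" "\<forall>x\<in>set w. x < b" "b < a"
  shows "primitive_R_word (a # w @ [b]) \<longleftrightarrow> core w"
proof -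
  let ?v = "a # w @ [b]"
  have wa: "\<forall>x\<in>set w. x < a" and dist: "distinct ?v"
    using assms by (auto dest: less_trans)
  have "(\<forall>x. strict_sublist x ?v \<and> length x \<ge> 4 \<longrightarrow> \<not> R_word x \<and> \<not> R_word (rev x)) \<longleftrightarrow>
      avoiding (a # w) \<and> avoiding (w @ [b])" (is "?L \<longleftrightarrow> ?R")
  proof
    assume L: ?L
    have "avoiding u" if u: "sublist u ?v" "length u < length ?v" for u
      unfolding avoiding_def
    proof (intro allI impI notI)
      fix p y q
      assume *: "sublist (p # y @ [q]) u" "forbidden p y q"
      then have "strict_sublist (p # y @ [q]) ?v" "length (p # y @ [q]) \<ge> 4"
        using u sublist_order.order_trans[OF *(1) u(1)] sublist_length_le[OF *(1)]
        by (auto simp: strict_sublist_def forbidden_def)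
      moreover have "distinct y"
        using distinct_sublist[OF _ dist, of "p # y @ [q]"] calculation(1)
        by (auto simp: strict_sublist_def)
      ultimately show False
        using L *(2) forbidden_iff_R_word[of y p q] by (auto simp: forbidden_def)
    qed
    from this[of "a # w"] this[of "w @ [b]"] show ?R
      by (simp add: sublist_Cons_snoc)
  next
    assume R: ?R
    show ?L
    proof (intro allI impI)
      fix x
      assume x: "strict_sublist x ?v \<and> length x \<ge> 4"
      then obtain p y q where xeq: "x = p # y @ [q]"
        by (cases x; cases "tl x" rule: rev_cases) auto
      have sub: "sublist x (a # w) \<or> sublist x (w @ [b])"
        using x by (auto simp: strict_sublist_def sublist_Cons_snoc)
      then have "\<not> forbidden p y q"
        using R by (auto simp: avoiding_def xeq)
      moreover have "distinct x"
        using x distinct_sublist[OF _ dist, of x] by (auto simp: strict_sublist_def)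
      ultimately show "\<not> R_word x \<and> \<not> R_word (rev x)"
        using forbidden_iff_R_word[of y p q] x by (auto simp: xeq)
    qed
  qed
  then show ?thesis
    using assms border_avoidingI[OF wa assms(3)] wa
    unfolding primitive_R_word_def core_def R_word_Cons_snoc by (auto simp: border_avoiding_def)
qed

lemma R_perms_iff:
  assumes "finite P" "P \<noteq> {}"
  shows "w \<in> R_perms P \<longleftrightarrow> core w \<and> set w = P"
proof -
  have "primitive_R_word ((Max P + 2) # w @ [Max P + 1]) \<longleftrightarrow> core w"
    if "distinct w" "set w = P"
    using that assms by (intro primitive_R_word_iff_core) (auto simp: less_Suc_eq_le)
  then show ?thesis
    by (auto simp: R_perms_def permutations_of_set_def core_def)
qed

section \<open>The maps follow the splitting\<close>

lemma phi_R_singleton: "phi_R [m] = Some (Node m {#})"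
  by (simp add: phi_R.simps)

lemma phi_R_split:
  assumes "\<forall>x\<in>set s \<union> set t. x < m" "s \<noteq> []"
  shows "phi_R (s @ m # t) =
    (if t = [] then map_option (\<lambda>T. Node m {#T#}) (phi_R (rev s))
     else Option.bind (phi_R (rev s)) (\<lambda>T. map_option (\<lambda>T'. Node m {#T, T'#}) (phi_R t)))"
proof -
  have m: "Max (set (s @ m # t)) = m"
    using assms by (intro Max_eqI) (auto simp: less_imp_le)
  have "takeWhile (\<lambda>x. x \<noteq> m) (s @ m # t) = s" "dropWhile (\<lambda>x. x \<noteq> m) (s @ m # t) = m # t"
    using assms by (subst takeWhile_append2 dropWhile_append2; auto)+
  then show ?thesis
    using assms by (subst phi_R.simps)
      (simp only: m Let_def, auto split: option.splits)
qed

text \<open>A multiset of two words can be read in two orders, but the strict inequality of last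
  letters admits at most one. This justifies the \<open>THE\<close> in \<open>psi_R\<close>.\<close>

lemma psi_R_node_unique:
  assumes "psi_R_node v M w" "psi_R_node v M w'"
  shows "w = w'"
  using assms by (auto elim!: psi_R_node.cases simp: add_eq_conv_ex add_mset_eq_single)

lemma psi_R_eqI: "psi_R_node v (image_mset psi_R ts) w \<Longrightarrow> psi_R (Node v ts) = w"
  by (simp, rule the_equality) (auto dest: psi_R_node_unique)

declare psi_R.simps [simp del]

section \<open>The two maps as mutual inverses\<close>

lemma split_at_Max:
  assumes "w \<noteq> []" "distinct (w :: nat list)"
  obtains s m t where "w = s @ m # t" "\<forall>x\<in>set s \<union> set t. x < m"
proof -
  have "Max (set w) \<in> set w"
    using assms by simp
  then obtain s t where w: "w = s @ Max (set w) # t"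
    by (meson split_list)
  moreover have "x < Max (set w)" if "x \<in> set s \<union> set t" for x
  proof -
    have "x \<in> set w" "x \<noteq> Max (set w)"
      using that assms(2) arg_cong[OF w, of set] arg_cong[OF w, of distinct] by auto
    then show ?thesis
      by (simp add: order_less_le)
  qed
  ultimately show thesis
    using that by blast
qed

text \<open>Induction on length along \<open>core_split\<close>. Since
  \<open>last (rev s) = hd s\<close>, the condition \<open>hd s < last t\<close> is the one by which
  \<open>psi_R\<close> puts the subtree of \<open>rev s\<close> first.\<close>

lemma phi_R_core:
  assumes "core w"
  shows "\<exists>T. phi_R w = Some T \<and> decreasing_012 T \<and> labels T = mset w \<and> psi_R T = w"
  using assms
proof (induction "length w" arbitrary: w rule: less_induct)
  case less
  then have "w \<noteq> []" "distinct w"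
    by (auto simp: core_def)
  then obtain s m t where w: "w = s @ m # t" and m: "\<forall>x\<in>set s \<union> set t. x < m"
    by (rule split_at_Max)
  show ?case
  proof (cases "s @ t = []")
    case True
    then show ?thesis
      by (auto simp: w phi_R_singleton intro!: decreasing_012.intros psi_R_eqI psi_R_node.intros)
  next
    case False
    then have *: "s \<noteq> []" "core (rev s)" "t \<noteq> [] \<Longrightarrow> core t" "t \<noteq> [] \<Longrightarrow> hd s < last t"
      using core_split[of s m t] less.prems \<open>distinct w\<close> m by (auto simp: w)
    obtain T where T: "phi_R (rev s) = Some T" "decreasing_012 T" "labels T = mset s"
        "psi_R T = rev s"
      using less.hyps[of "rev s"] * by (auto simp: w)
    show ?thesis
    proof (cases "t = []")
      case True
      have "psi_R (Node m {#T#}) = w"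
        using psi_R_node.intros(2)[of m "rev s"] by (intro psi_R_eqI) (simp add: T w True)
      then show ?thesis
        using T m * by (auto simp: w phi_R_split True intro!: decreasing_012.intros)
    next
      case False
      obtain T' where T': "phi_R t = Some T'" "decreasing_012 T'" "labels T' = mset t"
          "psi_R T' = t"
        using less.hyps[of t] * False by (auto simp: w)
      have "psi_R (Node m {#T, T'#}) = w"
        using psi_R_node.intros(3)[of "rev s" t m] * False
        by (intro psi_R_eqI) (simp add: T T' w last_rev)
      then show ?thesis
        using T T' m * False
        by (auto simp: w phi_R_split intro!: decreasing_012.intros)
    qed
  qed
qed

text \<open>Subtrees of a tree on \<open>[n]\<close> carry other label sets; distinctness of labels
  is inherited by them, so it is what the induction assumes.\<close>

lemma psi_R_decreasing:
  assumes "decreasing_012 T" "\<forall>x. count (labels T) x \<le> 1"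
  shows "core (psi_R T) \<and> mset (psi_R T) = labels T \<and> phi_R (psi_R T) = Some T"
  using assms
proof (induction T rule: decreasing_012.induct)
  case (1 ts v)
  have sub: "core (psi_R t) \<and> mset (psi_R t) = labels t \<and> phi_R (psi_R t) = Some t"
    if t: "t \<in># ts" for t
  proof -
    obtain us where "ts = add_mset t us"
      using t by (meson mset_add)
    then have "labels t \<subseteq># labels (Node v ts)"
      by (simp add: subseteq_mset_def)
    then have "\<forall>x. count (labels t) x \<le> 1"
      using "1.prems" by (blast intro: le_trans mset_subset_eq_count)
    then show ?thesis
      using "1.IH" t by blast
  qed
  have below: "x < v" if "t \<in># ts" "x \<in> set (psi_R t)" for t x
  proof -
    have "x \<in># labels t"
      using sub[OF that(1)] that(2) by (metis set_mset_mset)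
    with that(1) show ?thesis
      by (rule "1.hyps")
  qed
  have dist: "distinct w" if "mset w = labels (Node v ts)" for w
    unfolding distinct_count_atmost_1
  proof
    fix x
    have "count (mset w) x \<le> 1"
      using "1.prems" that by simp
    moreover have "count (mset w) x > 0 \<longleftrightarrow> x \<in> set w"
      by simp
    ultimately show "count (mset w) x = (if x \<in> set w then 1 else 0)"
      by (cases "x \<in> set w"; simp only: if_True if_False simp_thms; linarith)
  qed
  \<comment> \<open>The shapes are read off from a list enumerating the children.\<close>
  consider "ts = {#}" | t where "ts = {#t#}" | t t' where "ts = {#t, t'#}"
  proof -
    obtain us where us: "ts = mset us"
      by (metis ex_mset)
    then have "length us \<le> 2"
      using \<open>size ts \<le> 2\<close> by simp
    then consider "us = []" | t where "us = [t]" | t t' where "us = [t, t']"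
      by (cases us; cases "tl us"; cases "tl (tl us)") auto
    then show thesis
      using that us by cases auto
  qed
  then show ?case
  proof cases
    case 1
    then have "psi_R (Node v ts) = [v]"
      by (auto intro!: psi_R_eqI psi_R_node.intros)
    then show ?thesis
      by (simp add: 1 core_singleton phi_R_singleton)
  next
    case (2 t)
    let ?s = "rev (psi_R t)"
    have psi: "psi_R (Node v ts) = ?s @ [v]"
      by (auto simp: 2 intro!: psi_R_eqI psi_R_node.intros)
    moreover have mset: "mset (?s @ [v]) = labels (Node v ts)"
      using sub 2 by simp
    moreover have ne: "?s \<noteq> []"
      using sub 2 by (auto simp: core_def)
    moreover have "core (?s @ [v])"
      using core_split[of ?s v "[]"] dist[OF mset] ne below sub 2 by auto
    ultimately show ?thesis
      using phi_R_split[of ?s "[]" v] below sub 2 by auto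
  next
    case (3 t1 t2)
    have ne: "psi_R t \<noteq> []" if "t \<in># ts" for t
      using sub that by (auto simp: core_def)
    have "distinct (v # psi_R t1 @ psi_R t2)"
      using sub 3 by (intro dist) simp
    \<comment> \<open>The subtrees share no label, so their last letters differ and, as children are
      unordered, they can be renamed to put the smaller one first.\<close>
    then have "last (psi_R t1) \<noteq> last (psi_R t2)"
      using last_in_set[OF ne, of t1] last_in_set[OF ne, of t2] 3 by auto
    then obtain t t' where ts: "ts = {#t, t'#}" and less: "last (psi_R t) < last (psi_R t')"
      using 3 by (metis add_mset_commute linorder_neqE_nat)
    let ?s = "rev (psi_R t)" and ?t = "psi_R t'"
    have psi: "psi_R (Node v ts) = ?s @ v # ?t"
      using psi_R_node.intros(3)[OF less, of v] by (intro psi_R_eqI) (simp add: ts)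
    moreover have mset: "mset (?s @ v # ?t) = labels (Node v ts)"
      using sub ts by simp
    moreover have "?s \<noteq> []" "?t \<noteq> []"
      using ne ts by auto
    \<comment> \<open>By \<open>hd_rev\<close>, the choice of order \<open>less\<close> is the
      condition \<open>hd s < last t\<close> of \<open>core_split\<close>.\<close>
    moreover from this have "core (?s @ v # ?t)"
      using core_split[of ?s v ?t] dist[OF mset] below sub ts less by (auto simp: hd_rev)
    ultimately show ?thesis
      using phi_R_split[of ?s ?t v] below sub ts by auto
  qed
qed

theorem theorem9:
  fixes n :: nat
  assumes "n \<ge> 1"
  shows "(\<forall>w \<in> R_perms {1..n}. \<exists>T \<in> decreasing_012_trees {1..n}. phi_R w = Some T) \<and>
         (\<forall>T \<in> decreasing_012_trees {1..n}. psi_R T \<in> R_perms {1..n}) \<and>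
         bij_betw (\<lambda>w. the (phi_R w)) (R_perms {1..n}) (decreasing_012_trees {1..n}) \<and>
         bij_betw psi_R (decreasing_012_trees {1..n}) (R_perms {1..n}) \<and>
         (\<forall>w \<in> R_perms {1..n}. psi_R (the (phi_R w)) = w) \<and>
         (\<forall>T \<in> decreasing_012_trees {1..n}. phi_R (psi_R T) = Some T)"
proof -
  let ?P = "{1..n}" and ?R = "R_perms {1..n}" and ?D = "decreasing_012_trees {1..n}"
  have R_iff: "w \<in> ?R \<longleftrightarrow> core w \<and> set w = ?P" for w
    using assms by (intro R_perms_iff) auto
  have phi: "\<exists>T \<in> ?D. phi_R w = Some T \<and> psi_R T = w" if "w \<in> ?R" for w
  proof -
    have "mset w = mset_set ?P"
      using that unfolding R_iff core_def by (metis mset_set_set)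
    then show ?thesis
      using phi_R_core[of w] that unfolding R_iff by (auto simp: decreasing_012_trees_def)
  qed
  have psi: "psi_R T \<in> ?R \<and> phi_R (psi_R T) = Some T" if "T \<in> ?D" for T
  proof -
    have T: "decreasing_012 T" "labels T = mset_set ?P"
      using that by (auto simp: decreasing_012_trees_def)
    then have *: "core (psi_R T) \<and> mset (psi_R T) = labels T \<and> phi_R (psi_R T) = Some T"
      by (intro psi_R_decreasing) (auto simp: count_mset_set')
    then have "set (psi_R T) = ?P"
      using T by (metis finite_atLeastAtMost finite_set_mset_mset_set set_mset_mset)
    with * show ?thesis
      using R_iff by blast
  qed
  \<comment> \<open>\<open>phi\<close> and \<open>psi\<close> each supply one image inclusion and
    one inverse law.\<close>
  have "bij_betw (\<lambda>w. the (phi_R w)) ?R ?D"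
    by (rule bij_betw_byWitness[where f' = psi_R]) (use phi psi in force)+
  moreover have "bij_betw psi_R ?D ?R"
    by (rule bij_betw_byWitness[where f' = "\<lambda>w. the (phi_R w)"]) (use phi psi in force)+
  ultimately show ?thesis
    using phi psi by force
qed

end
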